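(* The category $\mathbf{GI\text{-}TopSys}$ is dually equivalent to the category $\mathbf{GA}$; that is, $\mathbf{GI\text{-}TopSys}$ is equivalent to $\mathbf{GA}^{op}$.
   Context: A Heyting algebra is an algebra $(A,\vee,\wedge,\rightarrow,\mathbf{1},\mathbf{0})$ such that $(A,\vee,\wedge,\mathbf{1},\mathbf{0})$ is a bounded distributive lattice and $\rightarrow$ is a binary operation adjoint to $\wedge$ ($c\wedge a\le b$ iff $c\le a\rightarrow b$). A Gödel algebra is a Heyting algebra satisfying prelinearity: $(a\rightarrow b)\vee(b\rightarrow a)=\mathbf{1}$ for all $a,b\in A$. A Heyting homomorphism is a map preserving $\wedge,\vee,\rightarrow,\mathbf{0}$. $\mathbf{GA}$ is the category of Gödel algebras and Heyting homomorphisms between them. $Hom(A,\{0,1\})$ denotes the set of all bounded distributive lattice homomorphisms from $A$ to the two-element algebra $\{0,1\}$, ordered pointwise: $h_1Rh_2$ iff $h_1(a)\le h_2(a)$ for all $a\in A$. A Gödel algebraic I-topological system is a triple $(X,\models,A)$ consisting of a nonempty set $X$, a Gödel algebra $A$ and a binary relation $\models$ from $X$ to $A$ such that: (1) $x\models\mathbf{0}$ for no $x\in X$; (2) $x\models a\wedge b$ iff $x\models a$ and $x\models b$; (3) $x\models a\vee b$ iff $x\models a$ or $x\models b$; (4) $x\models a\rightarrow b$ iff for all $y\in X$ such that $p^*(x)Rp^*(y)$, $y\not\models a$ or $y\models b$, where $p^*:X\to Hom(A,\{0,1\})$ is given by $p^*(x)(a)=1$ iff $x\models a$; (5) the map $p^*$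 is a bijection. $\mathbf{GI\text{-}TopSys}$ is the category whose objects are Gödel algebraic I-topological systems and whose morphisms $(X,\models,A)\to(Y,\models',B)$ are pairs $(f_1,f_2)$ with $f_1:X\to Y$ a map of sets, $f_2:B\to A$ a Heyting homomorphism, and $x\models f_2(b)$ iff $f_1(x)\models' b$ for all $x\in X$, $b\in B$. Identities are $(id_X,id_A)$ and composition is $(g_1,g_2)\circ(f_1,f_2)=(g_1\circ f_1,f_2\circ g_2)$.
   Formalization: GA is taken to consist of the Gödel algebras with 0 ≠ 1: the one-element algebra has no homomorphism to {0,1}, so no system with nonempty X has it, and with it GA would have a terminal object that the dual of GI-TopSys lacks. *)

theory Defs
  imports "HOL-Library.FuncSet" "HOL-Library.Equipollence" "HOL-Algebra.Congruence"
begin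

section \<open>Categories, functors and equivalence\<close>

text \<open>Hom-sets are indexed by source and target and need not be disjoint, so composition takes
  the three objects involved as arguments: \<open>Comp C X Y Z g f\<close> is the composite of
  \<open>f\<close> from \<open>X\<close> to \<open>Y\<close> with \<open>g\<close> from \<open>Y\<close> to \<open>Z\<close>.\<close>

record ('o, 'm) cat =
  Ob :: "'o set"
  Hom :: "'o \<Rightarrow> 'o \<Rightarrow> 'm set"
  Ident :: "'o \<Rightarrow> 'm"
  Comp :: "'o \<Rightarrow> 'o \<Rightarrow> 'o \<Rightarrow> 'm \<Rightarrow> 'm \<Rightarrow> 'm"

locale category =
  fixes C :: "('o, 'm) cat"
  assumes Ident_in: "X \<in> Ob C \<Longrightarrow> Ident C X \<in> Hom C X X"
    and Comp_in: "\<lbrakk>X \<in> Ob C; Y \<in> Ob C; Z \<in> Ob C; f \<in> Hom C X Y; g \<in> Hom C Y Z\<rbrakk>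
      \<Longrightarrow> Comp C X Y Z g f \<in> Hom C X Z"
    and Comp_Ident_right: "\<lbrakk>X \<in> Ob C; Y \<in> Ob C; f \<in> Hom C X Y\<rbrakk>
      \<Longrightarrow> Comp C X X Y f (Ident C X) = f"
    and Comp_Ident_left: "\<lbrakk>X \<in> Ob C; Y \<in> Ob C; f \<in> Hom C X Y\<rbrakk>
      \<Longrightarrow> Comp C X Y Y (Ident C Y) f = f"
    and Comp_assoc: "\<lbrakk>W \<in> Ob C; X \<in> Ob C; Y \<in> Ob C; Z \<in> Ob C;
        f \<in> Hom C W X; g \<in> Hom C X Y; h \<in> Hom C Y Z\<rbrakk>
      \<Longrightarrow> Comp C W X Z (Comp C X Y Z h g) f = Comp C W Y Z h (Comp C W X Y g f)"

definition op_cat :: "('o, 'm) cat \<Rightarrow> ('o, 'm) cat" where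
  "op_cat C = \<lparr>Ob = Ob C, Hom = (\<lambda>X Y. Hom C Y X), Ident = Ident C,
     Comp = (\<lambda>X Y Z g f. Comp C Z Y X f g)\<rparr>"

record ('o, 'm, 'p, 'n) func =
  on_Ob :: "'o \<Rightarrow> 'p"
  on_Hom :: "'o \<Rightarrow> 'o \<Rightarrow> 'm \<Rightarrow> 'n"

locale cat_functor =
  fixes C :: "('o, 'm) cat" and D :: "('p, 'n) cat" and F :: "('o, 'm, 'p, 'n) func"
  assumes on_Ob_in: "X \<in> Ob C \<Longrightarrow> on_Ob F X \<in> Ob D"
    and on_Hom_in: "\<lbrakk>X \<in> Ob C; Y \<in> Ob C; f \<in> Hom C X Y\<rbrakk>
      \<Longrightarrow> on_Hom F X Y f \<in> Hom D (on_Ob F X) (on_Ob F Y)"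
    and on_Hom_Ident: "X \<in> Ob C \<Longrightarrow> on_Hom F X X (Ident C X) = Ident D (on_Ob F X)"
    and on_Hom_Comp: "\<lbrakk>X \<in> Ob C; Y \<in> Ob C; Z \<in> Ob C; f \<in> Hom C X Y; g \<in> Hom C Y Z\<rbrakk>
      \<Longrightarrow> on_Hom F X Z (Comp C X Y Z g f) =
          Comp D (on_Ob F X) (on_Ob F Y) (on_Ob F Z) (on_Hom F Y Z g) (on_Hom F X Y f)"

definition id_func :: "('o, 'm, 'o, 'm) func" where
  "id_func = \<lparr>on_Ob = (\<lambda>X. X), on_Hom = (\<lambda>X Y f. f)\<rparr>"

definition comp_func ::
  "('p, 'n, 'q, 'k) func \<Rightarrow> ('o, 'm, 'p, 'n) func \<Rightarrow> ('o, 'm, 'q, 'k) func" where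
  "comp_func G F = \<lparr>on_Ob = (\<lambda>X. on_Ob G (on_Ob F X)),
     on_Hom = (\<lambda>X Y f. on_Hom G (on_Ob F X) (on_Ob F Y) (on_Hom F X Y f))\<rparr>"

definition iso_arrow :: "('o, 'm) cat \<Rightarrow> 'o \<Rightarrow> 'o \<Rightarrow> 'm \<Rightarrow> bool" where
  "iso_arrow C X Y f \<longleftrightarrow> f \<in> Hom C X Y \<and>
     (\<exists>g \<in> Hom C Y X. Comp C X Y X g f = Ident C X \<and> Comp C Y X Y f g = Ident C Y)"

definition nat_iso ::
  "('o, 'm) cat \<Rightarrow> ('p, 'n) cat \<Rightarrow> ('o, 'm, 'p, 'n) func \<Rightarrow> ('o, 'm, 'p, 'n) func
    \<Rightarrow> ('o \<Rightarrow> 'n) \<Rightarrow> bool" where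
  "nat_iso C D F G \<eta> \<longleftrightarrow>
     (\<forall>X \<in> Ob C. iso_arrow D (on_Ob F X) (on_Ob G X) (\<eta> X)) \<and>
     (\<forall>X \<in> Ob C. \<forall>Y \<in> Ob C. \<forall>f \<in> Hom C X Y.
        Comp D (on_Ob F X) (on_Ob F Y) (on_Ob G Y) (\<eta> Y) (on_Hom F X Y f) =
        Comp D (on_Ob F X) (on_Ob G X) (on_Ob G Y) (on_Hom G X Y f) (\<eta> X))"

definition equivalent_categories :: "('o, 'm) cat \<Rightarrow> ('p, 'n) cat \<Rightarrow> bool" where
  "equivalent_categories C D \<longleftrightarrow> category C \<and> category D \<and>
     (\<exists>F G \<eta> \<epsilon>. cat_functor C D F \<and> cat_functor D C G \<and>
        nat_iso C C id_func (comp_func G F) \<eta> \<and>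
        nat_iso D D (comp_func F G) id_func \<epsilon>)"


section \<open>Goedel algebras\<close>

record 'a heyting = "'a partial_object" +
  join :: "'a \<Rightarrow> 'a \<Rightarrow> 'a"  (infixl "\<squnion>\<index>" 65)
  meet :: "'a \<Rightarrow> 'a \<Rightarrow> 'a"  (infixl "\<sqinter>\<index>" 70)
  imp :: "'a \<Rightarrow> 'a \<Rightarrow> 'a"  (infixr "\<leadsto>\<index>" 60)
  one :: 'a  ("\<one>\<index>")
  zero :: 'a  ("\<zero>\<index>")

definition leq :: "'a heyting \<Rightarrow> 'a \<Rightarrow> 'a \<Rightarrow> bool"  (infix "\<sqsubseteq>\<index>" 50) where
  "a \<sqsubseteq>\<^bsub>A\<^esub> b \<longleftrightarrow> a \<sqinter>\<^bsub>A\<^esub> b = a"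

locale bounded_distributive_lattice =
  fixes A :: "'a heyting" (structure)
  assumes join_closed: "\<lbrakk>a \<in> carrier A; b \<in> carrier A\<rbrakk> \<Longrightarrow> a \<squnion> b \<in> carrier A"
    and meet_closed: "\<lbrakk>a \<in> carrier A; b \<in> carrier A\<rbrakk> \<Longrightarrow> a \<sqinter> b \<in> carrier A"
    and one_closed: "\<one> \<in> carrier A"
    and zero_closed: "\<zero> \<in> carrier A"
    and join_commute: "\<lbrakk>a \<in> carrier A; b \<in> carrier A\<rbrakk> \<Longrightarrow> a \<squnion> b = b \<squnion> a"
    and meet_commute: "\<lbrakk>a \<in> carrier A; b \<in> carrier A\<rbrakk> \<Longrightarrow> a \<sqinter> b = b \<sqinter> a"
    and join_assoc: "\<lbrakk>a \<in> carrier A; b \<in> carrier A; c \<in> carrier A\<rbrakk>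
      \<Longrightarrow> (a \<squnion> b) \<squnion> c = a \<squnion> (b \<squnion> c)"
    and meet_assoc: "\<lbrakk>a \<in> carrier A; b \<in> carrier A; c \<in> carrier A\<rbrakk>
      \<Longrightarrow> (a \<sqinter> b) \<sqinter> c = a \<sqinter> (b \<sqinter> c)"
    and join_absorb: "\<lbrakk>a \<in> carrier A; b \<in> carrier A\<rbrakk> \<Longrightarrow> a \<squnion> (a \<sqinter> b) = a"
    and meet_absorb: "\<lbrakk>a \<in> carrier A; b \<in> carrier A\<rbrakk> \<Longrightarrow> a \<sqinter> (a \<squnion> b) = a"
    and meet_join_distrib: "\<lbrakk>a \<in> carrier A; b \<in> carrier A; c \<in> carrier A\<rbrakk>
      \<Longrightarrow> a \<sqinter> (b \<squnion> c) = (a \<sqinter> b) \<squnion> (a \<sqinter> c)"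
    and zero_least: "a \<in> carrier A \<Longrightarrow> \<zero> \<sqsubseteq> a"
    and one_greatest: "a \<in> carrier A \<Longrightarrow> a \<sqsubseteq> \<one>"

locale heyting_algebra = bounded_distributive_lattice +
  assumes imp_closed: "\<lbrakk>a \<in> carrier A; b \<in> carrier A\<rbrakk> \<Longrightarrow> a \<leadsto> b \<in> carrier A"
    and adjoint: "\<lbrakk>a \<in> carrier A; b \<in> carrier A; c \<in> carrier A\<rbrakk>
      \<Longrightarrow> c \<sqinter> a \<sqsubseteq> b \<longleftrightarrow> c \<sqsubseteq> a \<leadsto> b"

locale godel_algebra = heyting_algebra +
  assumes prelinear: "\<lbrakk>a \<in> carrier A; b \<in> carrier A\<rbrakk>
      \<Longrightarrow> (a \<leadsto> b) \<squnion> (b \<leadsto> a) = \<one>"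

text \<open>Maps between carriers are extensional functions, so that equality of maps is equality in HOL.\<close>

definition heyting_hom :: "'a heyting \<Rightarrow> 'b heyting \<Rightarrow> ('a \<Rightarrow> 'b) set" where
  "heyting_hom A B = {f \<in> carrier A \<rightarrow>\<^sub>E carrier B.
     (\<forall>a \<in> carrier A. \<forall>b \<in> carrier A.
        f (a \<sqinter>\<^bsub>A\<^esub> b) = f a \<sqinter>\<^bsub>B\<^esub> f b \<and>
        f (a \<squnion>\<^bsub>A\<^esub> b) = f a \<squnion>\<^bsub>B\<^esub> f b \<and>
        f (a \<leadsto>\<^bsub>A\<^esub> b) = f a \<leadsto>\<^bsub>B\<^esub> f b) \<and>
     f \<zero>\<^bsub>A\<^esub> = \<zero>\<^bsub>B\<^esub>}"

text \<open>The two-element algebra is \<^typ>\<open>bool\<close>, with \<^const>\<open>False\<close> as 0 and \<^const>\<open>True\<close> as 1.\<close>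

definition two_hom :: "'a heyting \<Rightarrow> ('a \<Rightarrow> bool) set" where
  "two_hom A = {h \<in> carrier A \<rightarrow>\<^sub>E (UNIV :: bool set).
     (\<forall>a \<in> carrier A. \<forall>b \<in> carrier A.
        h (a \<sqinter>\<^bsub>A\<^esub> b) = (h a \<and> h b) \<and> h (a \<squnion>\<^bsub>A\<^esub> b) = (h a \<or> h b)) \<and>
     h \<zero>\<^bsub>A\<^esub> = False \<and> h \<one>\<^bsub>A\<^esub> = True}"

definition two_hom_le :: "'a heyting \<Rightarrow> ('a \<Rightarrow> bool) \<Rightarrow> ('a \<Rightarrow> bool) \<Rightarrow> bool" where
  "two_hom_le A h1 h2 \<longleftrightarrow> (\<forall>a \<in> carrier A. h1 a \<le> h2 a)"

text \<open>The algebras in the category are those with carrier in a given collection \<open>U\<close> of sets.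
  The one-element algebra is excluded: it has no homomorphism to the two-element algebra, whereas
  the point set of a topological system is nonempty, so no system has it as its algebra (see
  \<open>zero_neq_one\<close> below). If it were included, it would be a terminal object of the category of
  algebras, while the category of the algebras of topological systems has no terminal object in
  general, and the duality would fail.\<close>

definition GA :: "'a set set \<Rightarrow> ('a heyting, 'a \<Rightarrow> 'a) cat" where
  "GA U = \<lparr>Ob = {A. godel_algebra A \<and> \<zero>\<^bsub>A\<^esub> \<noteq> \<one>\<^bsub>A\<^esub> \<and> carrier A \<in> U},
     Hom = heyting_hom,
     Ident = (\<lambda>A. \<lambda>a\<in>carrier A. a),
     Comp = (\<lambda>A B C g f. compose (carrier A) g f)\<rparr>"


section \<open>Goedel algebraic I-topological systems\<close>

record ('x, 'a) topsys =
  points :: "'x set"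
  alg :: "'a heyting"
  sat :: "('x \<times> 'a) set"

definition pstar :: "('x, 'a) topsys \<Rightarrow> 'x \<Rightarrow> 'a \<Rightarrow> bool" where
  "pstar S x = (\<lambda>a\<in>carrier (alg S). (x, a) \<in> sat S)"

locale godel_I_topsys =
  fixes S :: "('x, 'a) topsys"
  assumes points_nonempty: "points S \<noteq> {}"
    and alg_godel: "godel_algebra (alg S)"
    and sat_subset: "sat S \<subseteq> points S \<times> carrier (alg S)"
    and sat_zero: "x \<in> points S \<Longrightarrow> (x, \<zero>\<^bsub>alg S\<^esub>) \<notin> sat S"
    and sat_meet: "\<lbrakk>x \<in> points S; a \<in> carrier (alg S); b \<in> carrier (alg S)\<rbrakk>
      \<Longrightarrow> (x, a \<sqinter>\<^bsub>alg S\<^esub> b) \<in> sat S \<longleftrightarrow> (x, a) \<in> sat S \<and> (x, b) \<in> sat S"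
    and sat_join: "\<lbrakk>x \<in> points S; a \<in> carrier (alg S); b \<in> carrier (alg S)\<rbrakk>
      \<Longrightarrow> (x, a \<squnion>\<^bsub>alg S\<^esub> b) \<in> sat S \<longleftrightarrow> (x, a) \<in> sat S \<or> (x, b) \<in> sat S"
    and sat_imp: "\<lbrakk>x \<in> points S; a \<in> carrier (alg S); b \<in> carrier (alg S)\<rbrakk>
      \<Longrightarrow> (x, a \<leadsto>\<^bsub>alg S\<^esub> b) \<in> sat S \<longleftrightarrow>
          (\<forall>y \<in> points S. two_hom_le (alg S) (pstar S x) (pstar S y) \<longrightarrow>
             (y, a) \<notin> sat S \<or> (y, b) \<in> sat S)"
    and pstar_bij: "bij_betw (pstar S) (points S) (two_hom (alg S))"

lemma (in godel_I_topsys) zero_neq_one: "\<zero>\<^bsub>alg S\<^esub> \<noteq> \<one>\<^bsub>alg S\<^esub>"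
proof -
  obtain x where "x \<in> points S" using points_nonempty by blast
  then have "pstar S x \<in> two_hom (alg S)" using pstar_bij by (rule bij_betwE[rule_format, rotated])
  then show ?thesis unfolding two_hom_def by force
qed

definition topsys_hom ::
  "('x, 'a) topsys \<Rightarrow> ('y, 'b) topsys \<Rightarrow> (('x \<Rightarrow> 'y) \<times> ('b \<Rightarrow> 'a)) set" where
  "topsys_hom S T = {(f1, f2). f1 \<in> points S \<rightarrow>\<^sub>E points T \<and> f2 \<in> heyting_hom (alg T) (alg S) \<and>
     (\<forall>x \<in> points S. \<forall>b \<in> carrier (alg T). (x, f2 b) \<in> sat S \<longleftrightarrow> (f1 x, b) \<in> sat T)}"

definition GI_TopSys ::
  "'x set set \<Rightarrow> 'a set set \<Rightarrow> (('x, 'a) topsys, ('x \<Rightarrow> 'x) \<times> ('a \<Rightarrow> 'a)) cat" where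
  "GI_TopSys V U = \<lparr>Ob = {S. godel_I_topsys S \<and> points S \<in> V \<and> carrier (alg S) \<in> U},
     Hom = topsys_hom,
     Ident = (\<lambda>S. (\<lambda>x\<in>points S. x, \<lambda>a\<in>carrier (alg S). a)),
     Comp = (\<lambda>S T R (g1, g2) (f1, f2).
       (compose (points S) g1 f1, compose (carrier (alg R)) f2 g2))\<rparr>"


section \<open>Size\<close>

text \<open>There is no type of all sets, so point sets range over a collection \<open>V\<close> and carriers of
  algebras over a collection \<open>U\<close>. All that is required is that every set of subsets of a
  member of \<open>U\<close> (in particular, up to bijection, every set of homomorphisms from an algebra on
  it to the two-element algebra) has a copy in \<open>V\<close>. The sets belonging to a Grothendieck universe
  satisfy this with \<open>U = V\<close>; the collections of all sets over \<open>'a\<close> and over \<open>'a set\<close>, for any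
  type \<open>'a\<close>, are another instance.\<close>

definition size_compatible :: "'a set set \<Rightarrow> 'x set set \<Rightarrow> bool" where
  "size_compatible U V \<longleftrightarrow> (\<forall>A \<in> U. \<forall>P. P \<subseteq> Pow A \<longrightarrow> (\<exists>X \<in> V. X \<approx> P))"

lemma size_compatible_UNIV: "size_compatible (UNIV :: 'a set set) (UNIV :: 'a set set set)"
  unfolding size_compatible_def using eqpoll_refl by blast

end

theory Submission
  imports Defs
begin

text \<open>The functor \<open>(X, \<Turnstile>, A) \<mapsto> A\<close> is fully faithful: condition (5) forces the point
  component of a morphism over \<open>f\<^sub>2\<close> to be \<open>x \<mapsto> (p\<^sup>*)\<^sup>-\<^sup>1 (p\<^sup>*(x) \<circ> f\<^sub>2)\<close>. It is
  surjective on objects, because every nontrivial algebra \<open>A\<close> carries the system whose points are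
  (a copy of) \<open>Hom(A, {0,1})\<close>; nonemptiness and condition (4) come from the prime filter theorem.\<close>

section \<open>Prime filters\<close>

context bounded_distributive_lattice
begin

text \<open>Apply \<open>meet_absorb\<close> to \<open>a\<close> and \<open>a \<sqinter> a\<close>:
  by \<open>join_absorb\<close> their join is \<open>a\<close> again.\<close>

lemma meet_idem: "a \<in> carrier A \<Longrightarrow> a \<sqinter> a = a"
  by (metis join_absorb meet_absorb meet_closed)

lemma leq_refl: "a \<in> carrier A \<Longrightarrow> a \<sqsubseteq> a"
  by (simp add: leq_def meet_idem)

lemma leq_trans:
  "\<lbrakk>a \<sqsubseteq> b; b \<sqsubseteq> c; a \<in> carrier A; b \<in> carrier A; c \<in> carrier A\<rbrakk> \<Longrightarrow> a \<sqsubseteq> c"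
  unfolding leq_def by (metis meet_assoc)

lemma leq_antisym: "\<lbrakk>a \<sqsubseteq> b; b \<sqsubseteq> a; a \<in> carrier A; b \<in> carrier A\<rbrakk> \<Longrightarrow> a = b"
  unfolding leq_def by (metis meet_commute)

lemma meet_leq_left: "\<lbrakk>a \<in> carrier A; b \<in> carrier A\<rbrakk> \<Longrightarrow> a \<sqinter> b \<sqsubseteq> a"
  unfolding leq_def by (metis meet_assoc meet_commute meet_idem)

lemma meet_leq_right: "\<lbrakk>a \<in> carrier A; b \<in> carrier A\<rbrakk> \<Longrightarrow> a \<sqinter> b \<sqsubseteq> b"
  unfolding leq_def by (metis meet_assoc meet_idem)

lemma meet_greatest:
  "\<lbrakk>c \<sqsubseteq> a; c \<sqsubseteq> b; a \<in> carrier A; b \<in> carrier A; c \<in> carrier A\<rbrakk> \<Longrightarrow> c \<sqsubseteq> a \<sqinter> b"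
  unfolding leq_def by (metis meet_assoc)

lemma meet_mono:
  assumes "a \<sqsubseteq> c" "b \<sqsubseteq> d" "a \<in> carrier A" "b \<in> carrier A" "c \<in> carrier A" "d \<in> carrier A"
  shows "a \<sqinter> b \<sqsubseteq> c \<sqinter> d"
  by (meson assms leq_trans meet_closed meet_greatest meet_leq_left meet_leq_right)

lemma join_upper_left: "\<lbrakk>a \<in> carrier A; b \<in> carrier A\<rbrakk> \<Longrightarrow> a \<sqsubseteq> a \<squnion> b"
  by (simp add: leq_def meet_absorb)

lemma join_upper_right: "\<lbrakk>a \<in> carrier A; b \<in> carrier A\<rbrakk> \<Longrightarrow> b \<sqsubseteq> a \<squnion> b"
  by (metis join_commute join_upper_left)

text \<open>The order is defined through meets, so the bound comes from distributing
  \<open>c\<close> over the join.\<close>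

lemma join_least:
  "\<lbrakk>a \<sqsubseteq> c; b \<sqsubseteq> c; a \<in> carrier A; b \<in> carrier A; c \<in> carrier A\<rbrakk> \<Longrightarrow> a \<squnion> b \<sqsubseteq> c"
  unfolding leq_def by (metis join_closed meet_commute meet_join_distrib)

text \<open>The improper filter \<open>carrier A\<close> is included; where a proper filter is
  wanted, an element to be avoided is named.\<close>

definition lattice_filter :: "'a set \<Rightarrow> bool" where
  "lattice_filter F \<longleftrightarrow> F \<subseteq> carrier A \<and> \<one> \<in> F \<and> (\<forall>a\<in>F. \<forall>b\<in>F. a \<sqinter> b \<in> F) \<and>
     (\<forall>a\<in>F. \<forall>b\<in>carrier A. a \<sqsubseteq> b \<longrightarrow> b \<in> F)"

text \<open>For a filter \<open>F\<close> and \<open>x\<close> in the carrier, this is the filter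
  generated by \<open>F\<close> and \<open>x\<close>.\<close>

definition filter_adjoin :: "'a set \<Rightarrow> 'a \<Rightarrow> 'a set" where
  "filter_adjoin F x = {c \<in> carrier A. \<exists>m\<in>F. m \<sqinter> x \<sqsubseteq> c}"

text \<open>The least filter, from which \<open>two_hom_nonempty\<close> starts.\<close>

lemma lattice_filter_one: "lattice_filter {\<one>}"
  unfolding lattice_filter_def
  by (auto simp: one_closed meet_idem intro: leq_antisym one_greatest)

lemma filter_adjoin_contains:
  assumes F: "lattice_filter F" and x: "x \<in> carrier A"
  shows "F \<subseteq> filter_adjoin F x" "x \<in> filter_adjoin F x"
proof -
  show "F \<subseteq> filter_adjoin F x"
    using F x unfolding lattice_filter_def filter_adjoin_def by (blast intro: meet_leq_left)
  show "x \<in> filter_adjoin F x"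
    using F x unfolding lattice_filter_def filter_adjoin_def
    by (blast intro: meet_leq_right one_closed)
qed

lemma lattice_filter_adjoin:
  assumes F: "lattice_filter F" and x: "x \<in> carrier A"
  shows "lattice_filter (filter_adjoin F x)"
proof -
  have "c \<sqinter> d \<in> filter_adjoin F x"
    if cd: "c \<in> filter_adjoin F x" "d \<in> filter_adjoin F x" for c d
  proof -
    obtain m n where mn: "m \<in> F" "n \<in> F" "m \<sqinter> x \<sqsubseteq> c" "n \<sqinter> x \<sqsubseteq> d"
      and c: "c \<in> carrier A" "d \<in> carrier A"
      using cd unfolding filter_adjoin_def by blast
    have in_A: "m \<in> carrier A" "n \<in> carrier A" "m \<sqinter> n \<in> F"
      using F mn unfolding lattice_filter_def by auto
    \<comment> \<open>The single witness \<open>m \<sqinter> n\<close> serves for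
      \<open>c \<sqinter> d\<close>, since it lies below both \<open>m\<close> and
      \<open>n\<close>.\<close>
    have "(m \<sqinter> n) \<sqinter> x \<sqsubseteq> m \<sqinter> x" "(m \<sqinter> n) \<sqinter> x \<sqsubseteq> n \<sqinter> x"
      using in_A x by (simp_all add: meet_mono meet_leq_left meet_leq_right leq_refl meet_closed)
    then have "(m \<sqinter> n) \<sqinter> x \<sqsubseteq> c \<sqinter> d"
      using mn c in_A x by (meson leq_trans meet_closed meet_greatest)
    then show ?thesis using in_A c unfolding filter_adjoin_def by (blast intro: meet_closed)
  qed
  moreover have "d \<in> filter_adjoin F x"
    if "c \<in> filter_adjoin F x" "d \<in> carrier A" "c \<sqsubseteq> d" for c d
    using that F x unfolding filter_adjoin_def lattice_filter_def
    by (blast intro: leq_trans meet_closed)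
  moreover have "\<one> \<in> filter_adjoin F x"
    using filter_adjoin_contains[OF F x] F unfolding lattice_filter_def by blast
  ultimately show ?thesis
    unfolding lattice_filter_def by (auto simp: filter_adjoin_def)
qed

text \<open>Zorn's lemma for the filters that extend \<open>F\<close> and omit \<open>b\<close>. The
  union of a nonempty chain of them is again one, because any two of its elements already lie in a
  common member.\<close>

lemma maximal_filter_avoiding:
  assumes F: "lattice_filter F" and b: "b \<notin> F"
  obtains M where "lattice_filter M" "F \<subseteq> M" "b \<notin> M"
    "\<And>N. \<lbrakk>lattice_filter N; M \<subseteq> N; b \<notin> N\<rbrakk> \<Longrightarrow> N = M"
proof -
  let ?S = "{N. lattice_filter N \<and> F \<subseteq> N \<and> b \<notin> N}"
  have "\<exists>M\<in>?S. \<forall>N\<in>?S. M \<subseteq> N \<longrightarrow> N = M"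
  proof (rule subset_Zorn_nonempty)
    show "?S \<noteq> {}" using F b by blast
    fix C assume ne: "C \<noteq> {}" and C: "subset.chain ?S C"
    then have CS: "C \<subseteq> ?S" and lin: "\<And>M N. M \<in> C \<Longrightarrow> N \<in> C \<Longrightarrow> M \<subseteq> N \<or> N \<subseteq> M"
      unfolding subset_chain_def by auto
    have "x \<sqinter> y \<in> \<Union>C" if xy: "x \<in> \<Union>C" "y \<in> \<Union>C" for x y
    proof -
      obtain N where "N \<in> C" "x \<in> N" "y \<in> N" using xy lin by (meson UnionE subsetD)
      moreover then have "lattice_filter N" using CS by blast
      ultimately show ?thesis unfolding lattice_filter_def by blast
    qed
    moreover have "y \<in> \<Union>C" if "x \<in> \<Union>C" "y \<in> carrier A" "x \<sqsubseteq> y" for x y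
      using that CS unfolding lattice_filter_def by blast
    \<comment> \<open>The top lies in the union because the chain has a member.\<close>
    moreover have "\<one> \<in> \<Union>C" "\<Union>C \<subseteq> carrier A"
      using ne CS unfolding lattice_filter_def by blast+
    ultimately have "lattice_filter (\<Union>C)" unfolding lattice_filter_def by blast
    then show "\<Union>C \<in> ?S" using ne CS by blast
  qed
  then show thesis using that by (smt (verit) mem_Collect_eq subset_trans)
qed

text \<open>A filter maximal among those avoiding \<open>b\<close> is prime: if \<open>x\<close> and
  \<open>y\<close> were both outside, adjoining either one would capture \<open>b\<close>, and by
  distributivity so would \<open>x \<squnion> y\<close>. The characteristic function of a prime
  filter is a homomorphism to the two-element algebra.\<close>

theorem prime_filter_extension:
  assumes F: "lattice_filter F" and b: "b \<in> carrier A" "b \<notin> F"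
  obtains h where "h \<in> two_hom A" "\<And>a. a \<in> F \<Longrightarrow> h a" "\<not> h b"
proof -
  obtain M where M: "lattice_filter M" "F \<subseteq> M" "b \<notin> M"
    and max: "\<And>N. \<lbrakk>lattice_filter N; M \<subseteq> N; b \<notin> N\<rbrakk> \<Longrightarrow> N = M"
    using maximal_filter_avoiding[OF F b(2)] by blast
  have MA: "M \<subseteq> carrier A" and M1: "\<one> \<in> M"
    and Mmeet: "\<And>x y. x \<in> M \<Longrightarrow> y \<in> M \<Longrightarrow> x \<sqinter> y \<in> M"
    and Mup: "\<And>x y. x \<in> M \<Longrightarrow> y \<in> carrier A \<Longrightarrow> x \<sqsubseteq> y \<Longrightarrow> y \<in> M"
    using M(1) unfolding lattice_filter_def by auto
  \<comment> \<open>Maximality: a filter properly larger than \<open>M\<close> must contain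
    \<open>b\<close>.\<close>
  have reach: "\<exists>m\<in>M. m \<sqinter> x \<sqsubseteq> b" if x: "x \<in> carrier A" "x \<notin> M" for x
  proof -
    have "filter_adjoin M x \<noteq> M" using filter_adjoin_contains(2)[OF M(1) x(1)] x(2) by blast
    then have "b \<in> filter_adjoin M x"
      using max[OF lattice_filter_adjoin[OF M(1) x(1)] filter_adjoin_contains(1)[OF M(1) x(1)]]
      by blast
    then show ?thesis unfolding filter_adjoin_def by blast
  qed
  have prime: "x \<in> M \<or> y \<in> M"
    if xy: "x \<in> carrier A" "y \<in> carrier A" "x \<squnion> y \<in> M" for x y
  proof (rule ccontr)
    assume "\<not> (x \<in> M \<or> y \<in> M)"
    then obtain m n where mn: "m \<in> M" "n \<in> M" "m \<sqinter> x \<sqsubseteq> b" "n \<sqinter> y \<sqsubseteq> b"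
      using reach xy by meson
    have mA: "m \<in> carrier A" "n \<in> carrier A" using mn MA by auto
    \<comment> \<open>One element of \<open>M\<close> that replaces both witnesses, so that
      distributivity can join the two bounds.\<close>
    let ?k = "m \<sqinter> n"
    have kA: "?k \<in> carrier A" using mA meet_closed by blast
    have "?k \<sqinter> x \<sqsubseteq> m \<sqinter> x" "?k \<sqinter> y \<sqsubseteq> n \<sqinter> y"
      using mA xy kA by (simp_all add: meet_mono meet_leq_left meet_leq_right leq_refl)
    then have "?k \<sqinter> x \<sqsubseteq> b" "?k \<sqinter> y \<sqsubseteq> b"
      using mn mA xy kA b(1) by (meson leq_trans meet_closed)+
    then have "?k \<sqinter> (x \<squnion> y) \<sqsubseteq> b"
      using kA xy b(1) by (simp add: meet_join_distrib join_least meet_closed)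
    moreover have "?k \<sqinter> (x \<squnion> y) \<in> M" using mn xy Mmeet by blast
    ultimately show False using Mup b(1) M(3) by blast
  qed
  \<comment> \<open>The characteristic function of \<open>M\<close>, restricted to the carrier
    because members of \<open>two_hom A\<close> are extensional.\<close>
  define h where "h = (\<lambda>a\<in>carrier A. a \<in> M)"
  have "x \<sqinter> y \<in> M \<longleftrightarrow> x \<in> M \<and> y \<in> M" if "x \<in> carrier A" "y \<in> carrier A" for x y
    using that Mmeet Mup meet_leq_left meet_leq_right meet_closed by meson
  moreover have "x \<squnion> y \<in> M \<longleftrightarrow> x \<in> M \<or> y \<in> M" if "x \<in> carrier A" "y \<in> carrier A" for x y
    using that prime Mup join_upper_left join_upper_right join_closed by meson
  moreover have "\<zero> \<notin> M" using Mup b(1) M(3) zero_least by blast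
  ultimately have "h \<in> two_hom A"
    using M1 unfolding two_hom_def h_def
    by (auto simp: meet_closed join_closed zero_closed one_closed)
  moreover have "h a" if "a \<in> F" for a using that M(2) MA unfolding h_def by auto
  moreover have "\<not> h b" using b M(3) unfolding h_def by simp
  ultimately show thesis using that by blast
qed

lemma two_hom_mono:
  "\<lbrakk>h \<in> two_hom A; h a; a \<sqsubseteq> b; a \<in> carrier A; b \<in> carrier A\<rbrakk> \<Longrightarrow> h b"
  unfolding two_hom_def leq_def by force

text \<open>Nontriviality puts \<open>\<zero>\<close> outside the filter \<open>{\<one>}\<close>, so
  the prime filter theorem applies with \<open>\<zero>\<close> as the avoided element.\<close>

lemma two_hom_nonempty: "\<zero> \<noteq> \<one> \<Longrightarrow> two_hom A \<noteq> {}"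
  using prime_filter_extension[OF lattice_filter_one zero_closed] by auto

text \<open>Turns a homomorphism into a filter, which can then be enlarged to find homomorphisms
  above it.\<close>

lemma lattice_filter_of_two_hom:
  assumes h: "h \<in> two_hom A"
  shows "lattice_filter {a \<in> carrier A. h a}"
  using h two_hom_mono[OF h] unfolding lattice_filter_def
  by (auto simp: two_hom_def meet_closed one_closed)

lemma two_hom_extensional: "h \<in> two_hom A \<Longrightarrow> h \<in> extensional (carrier A)"
  by (simp add: two_hom_def PiE_def)

end

section \<open>Implication and its Kripke reading over the homomorphisms to the two-element
  algebra\<close>

context heyting_algebra
begin

lemma modus_ponens: "\<lbrakk>a \<in> carrier A; b \<in> carrier A\<rbrakk> \<Longrightarrow> (a \<leadsto> b) \<sqinter> a \<sqsubseteq> b"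
  by (simp add: adjoint imp_closed leq_refl)

text \<open>By adjunction the claim is
  \<open>\<one> \<sqinter> \<zero> \<sqsubseteq> \<zero>\<close>. It expresses the top through
  operations that \<open>heyting_hom\<close> preserves explicitly.\<close>

lemma zero_imp_zero: "\<zero> \<leadsto> \<zero> = \<one>"
proof (rule leq_antisym)
  show "\<one> \<sqsubseteq> \<zero> \<leadsto> \<zero>"
    using adjoint[OF zero_closed zero_closed one_closed] meet_leq_right one_closed zero_closed
    by blast
qed (simp_all add: one_greatest imp_closed zero_closed one_closed)

text \<open>Forwards, \<open>k\<close> inherits \<open>a \<leadsto> b\<close> from \<open>h\<close>
  and modus ponens applies. Backwards, if \<open>h\<close> rejects \<open>a \<leadsto> b\<close>,
  the filter generated by the truth set of \<open>h\<close> and \<open>a\<close> omits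
  \<open>b\<close>, and a prime extension of it refutes the right side. This yields condition (4)
  for the system of an algebra.\<close>

lemma two_hom_imp_iff:
  assumes h: "h \<in> two_hom A" and a: "a \<in> carrier A" and b: "b \<in> carrier A"
  shows "h (a \<leadsto> b) \<longleftrightarrow> (\<forall>k\<in>two_hom A. two_hom_le A h k \<longrightarrow> \<not> k a \<or> k b)"
proof
  assume hab: "h (a \<leadsto> b)"
  show "\<forall>k\<in>two_hom A. two_hom_le A h k \<longrightarrow> \<not> k a \<or> k b"
  proof (intro ballI impI, rule ccontr)
    fix k assume k: "k \<in> two_hom A" "two_hom_le A h k" "\<not> (\<not> k a \<or> k b)"
    have "k (a \<leadsto> b)" using k hab a b imp_closed unfolding two_hom_le_def by auto
    then have "k ((a \<leadsto> b) \<sqinter> a)" using k a b imp_closed unfolding two_hom_def by auto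
    then have "k b" using two_hom_mono[OF k(1) _ modus_ponens] a b meet_closed imp_closed by blast
    with k show False by blast
  qed
next
  assume R: "\<forall>k\<in>two_hom A. two_hom_le A h k \<longrightarrow> \<not> k a \<or> k b"
  show "h (a \<leadsto> b)"
  proof (rule ccontr)
    assume nh: "\<not> h (a \<leadsto> b)"
    let ?F = "{c \<in> carrier A. h c}"
    have F: "lattice_filter ?F" by (rule lattice_filter_of_two_hom[OF h])
    \<comment> \<open>Otherwise some \<open>c\<close> with \<open>h c\<close> has
      \<open>c \<sqinter> a \<sqsubseteq> b\<close>, so
      \<open>c \<sqsubseteq> a \<leadsto> b\<close> by adjunction, and \<open>h\<close> would accept
      \<open>a \<leadsto> b\<close>.\<close>
    have "b \<notin> filter_adjoin ?F a"
      using nh a b two_hom_mono[OF h] unfolding filter_adjoin_def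
      by (auto simp: adjoint imp_closed)
    then obtain k where k: "k \<in> two_hom A" "\<And>c. c \<in> filter_adjoin ?F a \<Longrightarrow> k c" "\<not> k b"
      using prime_filter_extension[OF lattice_filter_adjoin[OF F a] b] by blast
    have "k a" "two_hom_le A h k"
      using k(2) filter_adjoin_contains[OF F a] unfolding two_hom_le_def by auto
    with R k show False by blast
  qed
qed

end

section \<open>The categories\<close>

text \<open>The top is \<open>\<zero> \<leadsto> \<zero>\<close>, so preserving zero and implication
  suffices.\<close>

lemma heyting_hom_one:
  assumes "heyting_algebra A" "heyting_algebra B" "f \<in> heyting_hom A B"
  shows "f \<one>\<^bsub>A\<^esub> = \<one>\<^bsub>B\<^esub>"
proof -
  interpret A: heyting_algebra A by fact
  interpret B: heyting_algebra B by fact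
  have "f (\<zero>\<^bsub>A\<^esub> \<leadsto>\<^bsub>A\<^esub> \<zero>\<^bsub>A\<^esub>) = \<zero>\<^bsub>B\<^esub> \<leadsto>\<^bsub>B\<^esub> \<zero>\<^bsub>B\<^esub>"
    using assms(3) A.zero_closed unfolding heyting_hom_def by auto
  then show ?thesis by (simp add: A.zero_imp_zero B.zero_imp_zero)
qed

lemma heyting_hom_id:
  assumes "heyting_algebra A"
  shows "(\<lambda>a\<in>carrier A. a) \<in> heyting_hom A A"
proof -
  interpret heyting_algebra A by fact
  show ?thesis
    by (auto simp: heyting_hom_def meet_closed join_closed imp_closed zero_closed)
qed

lemma heyting_hom_compose:
  assumes "heyting_algebra A" "f \<in> heyting_hom A B" "g \<in> heyting_hom B C"
  shows "compose (carrier A) g f \<in> heyting_hom A C"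
proof -
  interpret heyting_algebra A by fact
  have fA: "f a \<in> carrier B" if "a \<in> carrier A" for a
    using assms(2) that by (auto simp: heyting_hom_def)
  have gB: "g b \<in> carrier C" if "b \<in> carrier B" for b
    using assms(3) that by (auto simp: heyting_hom_def)
  show ?thesis
    using assms(2,3)
    by (auto simp: heyting_hom_def compose_def meet_closed join_closed imp_closed zero_closed fA gB)
qed

text \<open>The contravariant action of Hom(-, {0,1}) on Heyting homomorphisms; it supplies the
  point components of morphisms.\<close>

lemma two_hom_compose:
  assumes "heyting_algebra A" "heyting_algebra B" "f \<in> heyting_hom A B" "h \<in> two_hom B"
  shows "compose (carrier A) h f \<in> two_hom A"
proof -
  interpret heyting_algebra A by fact
  have fA: "f a \<in> carrier B" if "a \<in> carrier A" for a
    using assms(3) that by (auto simp: heyting_hom_def)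
  show ?thesis
    using assms(3,4) heyting_hom_one[OF assms(1-3)]
    by (auto simp: heyting_hom_def two_hom_def compose_def meet_closed join_closed
        zero_closed one_closed fA)
qed

section \<open>The category laws for algebras and for systems\<close>

lemma godel_imp_heyting: "godel_algebra A \<Longrightarrow> heyting_algebra A"
  by (simp add: godel_algebra_def)

lemma category_GA: "category (GA U)"
proof
  fix X assume "X \<in> Ob (GA U)"
  then show "Ident (GA U) X \<in> Hom (GA U) X X"
    by (simp add: GA_def godel_imp_heyting heyting_hom_id)
next
  fix X Y Z f g
  assume "X \<in> Ob (GA U)" "f \<in> Hom (GA U) X Y" "g \<in> Hom (GA U) Y Z"
  then show "Comp (GA U) X Y Z g f \<in> Hom (GA U) X Z"
    using heyting_hom_compose[OF godel_imp_heyting] by (auto simp: GA_def)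
next
  fix X Y f assume "f \<in> Hom (GA U) X Y"
  then have f: "f \<in> carrier X \<rightarrow>\<^sub>E carrier Y" by (simp add: GA_def heyting_hom_def)
  show "Comp (GA U) X X Y f (Ident (GA U) X) = f"
    "Comp (GA U) X Y Y (Ident (GA U) Y) f = f"
    \<comment> \<open>Extensionality of \<open>f\<close> gives these equations outside the carrier
      as well.\<close>
    using f by (auto simp: GA_def compose_def PiE_def extensional_def Pi_def fun_eq_iff)
next
  fix W X Y Z f g h
  assume "f \<in> Hom (GA U) W X"
  then have "f \<in> carrier W \<rightarrow> carrier X" by (auto simp: GA_def heyting_hom_def)
  then show "Comp (GA U) W X Z (Comp (GA U) X Y Z h g) f =
      Comp (GA U) W Y Z h (Comp (GA U) W X Y g f)"
    by (simp add: GA_def compose_assoc)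
qed

lemma category_op_cat: "category C \<Longrightarrow> category (op_cat C)"
  unfolding category_def op_cat_def by simp

lemma topsys_alg_heyting: "godel_I_topsys S \<Longrightarrow> heyting_algebra (alg S)"
  by (simp add: godel_I_topsys_def godel_algebra_def)

lemma topsys_hom_id:
  assumes "godel_I_topsys S"
  shows "(\<lambda>x\<in>points S. x, \<lambda>a\<in>carrier (alg S). a) \<in> topsys_hom S S"
  using heyting_hom_id[OF topsys_alg_heyting[OF assms]] by (auto simp: topsys_hom_def)

lemma topsys_hom_compose:
  assumes "godel_I_topsys R" "(f1, f2) \<in> topsys_hom S T" "(g1, g2) \<in> topsys_hom T R"
  shows "(compose (points S) g1 f1, compose (carrier (alg R)) f2 g2) \<in> topsys_hom S R"
proof -
  have "compose (carrier (alg R)) f2 g2 \<in> heyting_hom (alg R) (alg S)"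
    using assms heyting_hom_compose[OF topsys_alg_heyting] by (auto simp: topsys_hom_def)
  moreover have "g2 b \<in> carrier (alg T)" if "b \<in> carrier (alg R)" for b
    using assms(3) that by (auto simp: topsys_hom_def heyting_hom_def)
  ultimately show ?thesis
    using assms(2,3) by (auto simp: topsys_hom_def compose_def)
qed

lemma category_GI_TopSys: "category (GI_TopSys V U)"
proof
  fix X :: "('a, 'b) topsys" assume "X \<in> Ob (GI_TopSys V U)"
  then show "Ident (GI_TopSys V U) X \<in> Hom (GI_TopSys V U) X X"
    by (simp add: GI_TopSys_def topsys_hom_id)
next
  fix X Y Z :: "('a, 'b) topsys" and f g
  assume "Z \<in> Ob (GI_TopSys V U)" "f \<in> Hom (GI_TopSys V U) X Y" "g \<in> Hom (GI_TopSys V U) Y Z"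
  then show "Comp (GI_TopSys V U) X Y Z g f \<in> Hom (GI_TopSys V U) X Z"
    using topsys_hom_compose by (cases f; cases g) (auto simp: GI_TopSys_def)
next
  fix X Y :: "('a, 'b) topsys" and f assume f: "f \<in> Hom (GI_TopSys V U) X Y"
  obtain f1 f2 where [simp]: "f = (f1, f2)" by (cases f)
  have "f1 \<in> points X \<rightarrow>\<^sub>E points Y" "f2 \<in> carrier (alg Y) \<rightarrow>\<^sub>E carrier (alg X)"
    using f by (auto simp: GI_TopSys_def topsys_hom_def heyting_hom_def)
  then show "Comp (GI_TopSys V U) X X Y f (Ident (GI_TopSys V U) X) = f"
    "Comp (GI_TopSys V U) X Y Y (Ident (GI_TopSys V U) Y) f = f"
    by (auto simp: GI_TopSys_def compose_def PiE_def extensional_def Pi_def fun_eq_iff)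
next
  fix W X Y Z :: "('a, 'b) topsys" and f g h :: "('a \<Rightarrow> 'a) \<times> ('b \<Rightarrow> 'b)"
  assume f: "f \<in> Hom (GI_TopSys V U) W X" and h: "h \<in> Hom (GI_TopSys V U) Y Z"
  obtain f1 f2 g1 g2 h1 h2 where [simp]: "f = (f1, f2)" "g = (g1, g2)" "h = (h1, h2)"
    by (meson surj_pair)
  \<comment> \<open>\<open>compose_assoc\<close> asks where the map applied first lands: on points
    this is \<open>f1\<close>, on algebras, where composition is reversed, it is
    \<open>h2\<close>.\<close>
  have "f1 \<in> points W \<rightarrow> points X" "h2 \<in> carrier (alg Z) \<rightarrow> carrier (alg Y)"
    using f h by (auto simp: GI_TopSys_def topsys_hom_def heyting_hom_def)
  then show "Comp (GI_TopSys V U) W X Z (Comp (GI_TopSys V U) X Y Z h g) f =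
      Comp (GI_TopSys V U) W Y Z h (Comp (GI_TopSys V U) W X Y g f)"
    by (simp add: GI_TopSys_def compose_assoc)
qed

section \<open>The forgetful functor is fully faithful\<close>

text \<open>This is the satisfaction condition of a morphism, read as an equation of functions; it
  shows that \<open>f2\<close> determines the image of each point under
  \<open>pstar T\<close>.\<close>

lemma pstar_topsys_hom:
  assumes "(f1, f2) \<in> topsys_hom S T" "x \<in> points S"
  shows "pstar T (f1 x) = compose (carrier (alg T)) (pstar S x) f2"
  using assms by (auto simp: topsys_hom_def heyting_hom_def pstar_def compose_def fun_eq_iff)

text \<open>Faithfulness: by \<open>pstar_topsys_hom\<close> the point maps agree after
  \<open>pstar T\<close>, which is injective by condition (5).\<close>

lemma topsys_hom_eqI:
  assumes T: "godel_I_topsys T" and f: "f \<in> topsys_hom S T" and g: "g \<in> topsys_hom S T"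
    and eq: "snd f = snd g"
  shows "f = g"
proof -
  obtain f1 g1 h where [simp]: "f = (f1, h)" "g = (g1, h)" using eq by (cases f; cases g) auto
  have ext: "f1 \<in> points S \<rightarrow>\<^sub>E points T" "g1 \<in> points S \<rightarrow>\<^sub>E points T"
    using f g by (auto simp: topsys_hom_def)
  have "f1 x = g1 x" if x: "x \<in> points S" for x
  proof (rule inj_onD)
    show "inj_on (pstar T) (points T)"
      using godel_I_topsys.pstar_bij[OF T] by (rule bij_betw_imp_inj_on)
    show "pstar T (f1 x) = pstar T (g1 x)"
      using pstar_topsys_hom[of f1 h S T x] pstar_topsys_hom[of g1 h S T x] f g x by simp
  qed (use ext x in auto)
  then have "f1 = g1" using ext by (blast intro: PiE_ext)
  then show ?thesis by simp
qed

text \<open>The only candidate for a morphism with algebra component \<open>f\<close>, as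
  \<open>pstar_topsys_hom\<close> dictates its point map.\<close>

definition topsys_lift ::
  "('x, 'a) topsys \<Rightarrow> ('y, 'b) topsys \<Rightarrow> ('b \<Rightarrow> 'a) \<Rightarrow> ('x \<Rightarrow> 'y) \<times> ('b \<Rightarrow> 'a)" where
  "topsys_lift S T f = (\<lambda>x\<in>points S. inv_into (points T) (pstar T)
     (compose (carrier (alg T)) (pstar S x) f), f)"

lemma snd_topsys_lift [simp]: "snd (topsys_lift S T f) = f"
  by (simp add: topsys_lift_def)

text \<open>Fullness: precomposition with \<open>f\<close> sends \<open>pstar S x\<close> into
  \<open>two_hom (alg T)\<close>, which \<open>pstar T\<close> covers by condition (5), so
  \<open>inv_into\<close> picks a genuine preimage.\<close>

lemma topsys_lift_in:
  assumes S: "godel_I_topsys S" and T: "godel_I_topsys T"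
    and f: "f \<in> heyting_hom (alg T) (alg S)"
  shows "topsys_lift S T f \<in> topsys_hom S T"
proof -
  define f1 where "f1 = (\<lambda>x\<in>points S. inv_into (points T) (pstar T)
     (compose (carrier (alg T)) (pstar S x) f))"
  have im: "pstar T ` points T = two_hom (alg T)"
    using godel_I_topsys.pstar_bij[OF T] by (rule bij_betw_imp_surj_on)
  have f1: "f1 x \<in> points T \<and> pstar T (f1 x) = compose (carrier (alg T)) (pstar S x) f"
    if x: "x \<in> points S" for x
  proof -
    have "pstar S x \<in> two_hom (alg S)"
      using godel_I_topsys.pstar_bij[OF S] x by (rule bij_betw_apply)
    then have "compose (carrier (alg T)) (pstar S x) f \<in> pstar T ` points T"
      unfolding im by (rule two_hom_compose[OF topsys_alg_heyting[OF T] topsys_alg_heyting[OF S] f])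
    then show ?thesis
      using x unfolding f1_def by (simp add: inv_into_into f_inv_into_f)
  qed
  have "(x, f b) \<in> sat S \<longleftrightarrow> (f1 x, b) \<in> sat T"
    if x: "x \<in> points S" and b: "b \<in> carrier (alg T)" for x b
  proof -
    have "f b \<in> carrier (alg S)" using f b by (auto simp: heyting_hom_def)
    \<comment> \<open>Evaluated at \<open>b\<close>, the equation for \<open>pstar T (f1 x)\<close>
      is the required equivalence.\<close>
    then show ?thesis
      using fun_cong[OF conjunct2[OF f1[OF x]], of b] b by (simp add: pstar_def compose_def)
  qed
  moreover have "f1 \<in> points S \<rightarrow>\<^sub>E points T" using f1 by (auto simp: f1_def)
  ultimately show ?thesis
    using f unfolding topsys_lift_def f1_def[symmetric] topsys_hom_def by simp
qed

section \<open>The system of an algebra\<close>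

text \<open>A homomorphism is determined by its truth set, being extensional. This gives the form
  that \<open>size_compatible\<close> speaks about.\<close>

lemma two_hom_eqpoll_subset_Pow: "\<exists>P. P \<subseteq> Pow (carrier A) \<and> P \<approx> two_hom A"
proof -
  let ?t = "\<lambda>h. {a \<in> carrier A. h a}"
  have "inj_on ?t (two_hom A)"
  proof (rule inj_onI)
    fix h k assume hk: "h \<in> two_hom A" "k \<in> two_hom A" and eq: "?t h = ?t k"
    show "h = k"
    proof (rule PiE_ext)
      show "h \<in> carrier A \<rightarrow>\<^sub>E UNIV" "k \<in> carrier A \<rightarrow>\<^sub>E UNIV" using hk by (auto simp: two_hom_def)
      fix a assume "a \<in> carrier A"
      then show "h a = k a" using eq by blast
    qed
  qed
  then have "?t ` two_hom A \<approx> two_hom A" by (rule inj_on_image_eqpoll_self)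
  moreover have "?t ` two_hom A \<subseteq> Pow (carrier A)" by blast
  ultimately show ?thesis by blast
qed

lemma size_compatible_two_hom:
  assumes "size_compatible U V" "carrier A \<in> U"
  shows "\<exists>X\<in>V. \<exists>e. bij_betw e X (two_hom A)"
  using assms two_hom_eqpoll_subset_Pow[of A] unfolding size_compatible_def eqpoll_def
  by (meson bij_betw_trans)

text \<open>Satisfaction is set up so that \<open>pstar\<close> coincides with \<open>e\<close> on
  \<open>X\<close>. Condition (5) is then the bijectivity of \<open>e\<close>, condition (4) is
  \<open>two_hom_imp_iff\<close>, and the lattice conditions say that each \<open>e x\<close> is a
  homomorphism.\<close>

lemma godel_I_topsys_of_bij:
  assumes A: "godel_algebra A" and nontriv: "\<zero>\<^bsub>A\<^esub> \<noteq> \<one>\<^bsub>A\<^esub>"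
    and e: "bij_betw e X (two_hom A)"
  shows "godel_I_topsys \<lparr>points = X, alg = A, sat = {(x, a). x \<in> X \<and> a \<in> carrier A \<and> e x a}\<rparr>"
    (is "godel_I_topsys ?S")
proof -
  interpret godel_algebra A by fact
  have eX: "e x \<in> two_hom A" if "x \<in> X" for x using e that by (rule bij_betw_apply)
  have im: "e ` X = two_hom A" using e by (rule bij_betw_imp_surj_on)
  have pe: "pstar ?S x = e x" if "x \<in> X" for x
  proof
    fix a show "pstar ?S x a = e x a"
      using that two_hom_extensional[OF eX[OF that]]
      by (cases "a \<in> carrier A") (simp_all add: pstar_def extensional_def)
  qed
  show ?thesis
  proof (rule godel_I_topsys.intro)
    show "points ?S \<noteq> {}" using im two_hom_nonempty[OF nontriv] by auto
    show "godel_algebra (alg ?S)" using A by simp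
    show "sat ?S \<subseteq> points ?S \<times> carrier (alg ?S)" by auto
    show "bij_betw (pstar ?S) (points ?S) (two_hom (alg ?S))"
      using e bij_betw_cong[of X "pstar ?S" e] pe by simp
  next
    fix x assume "x \<in> points ?S"
    then show "(x, \<zero>\<^bsub>alg ?S\<^esub>) \<notin> sat ?S" using eX by (auto simp: two_hom_def)
  next
    fix x a b assume x: "x \<in> points ?S" and a: "a \<in> carrier (alg ?S)" and b: "b \<in> carrier (alg ?S)"
    show "(x, a \<sqinter>\<^bsub>alg ?S\<^esub> b) \<in> sat ?S \<longleftrightarrow> (x, a) \<in> sat ?S \<and> (x, b) \<in> sat ?S"
      "(x, a \<squnion>\<^bsub>alg ?S\<^esub> b) \<in> sat ?S \<longleftrightarrow> (x, a) \<in> sat ?S \<or> (x, b) \<in> sat ?S"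
      using x a b eX[of x] by (auto simp: two_hom_def meet_closed join_closed)
    \<comment> \<open>Since \<open>e\<close> is onto, quantifying over homomorphisms is the same as
      quantifying over points.\<close>
    have "(\<forall>k\<in>two_hom A. two_hom_le A (e x) k \<longrightarrow> \<not> k a \<or> k b) \<longleftrightarrow>
        (\<forall>y\<in>X. two_hom_le A (e x) (e y) \<longrightarrow> \<not> e y a \<or> e y b)"
      by (simp flip: im)
    then show "(x, a \<leadsto>\<^bsub>alg ?S\<^esub> b) \<in> sat ?S \<longleftrightarrow> (\<forall>y\<in>points ?S.
        two_hom_le (alg ?S) (pstar ?S x) (pstar ?S y) \<longrightarrow> (y, a) \<notin> sat ?S \<or> (y, b) \<in> sat ?S)"
      using two_hom_imp_iff[OF eX, of x a b] x a b by (simp add: pe imp_closed)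
  qed
qed

text \<open>The algebra is recovered as an equality, not merely up to isomorphism, which later
  allows identities as the counit.\<close>

lemma GI_TopSys_over_algebra:
  fixes U :: "'a set set" and V :: "'x set set"
  assumes "size_compatible U V" "A \<in> Ob (GA U)"
  shows "\<exists>S \<in> Ob (GI_TopSys V U). alg S = A"
proof -
  obtain X :: "'x set" and e where X: "X \<in> V" "bij_betw e X (two_hom A)"
    using size_compatible_two_hom assms unfolding GA_def by force
  then show ?thesis
    using godel_I_topsys_of_bij[of A e X] assms(2)
    by (intro bexI[of _ "\<lparr>points = X, alg = A, sat = {(x, a). x \<in> X \<and> a \<in> carrier A \<and> e x a}\<rparr>"])
      (auto simp: GA_def GI_TopSys_def)
qed

section \<open>The equivalence\<close>

lemma snd_Comp_GI_TopSys:
  "snd (Comp (GI_TopSys V U) S T R g f) = compose (carrier (alg R)) (snd f) (snd g)"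
  by (cases f; cases g) (simp add: GI_TopSys_def)

lemma snd_Ident_GI_TopSys: "snd (Ident (GI_TopSys V U) S) = (\<lambda>a\<in>carrier (alg S). a)"
  by (simp add: GI_TopSys_def)

text \<open>Reduces equations between morphisms of systems to their algebra components.\<close>

lemma GI_TopSys_hom_eqI:
  "\<lbrakk>T \<in> Ob (GI_TopSys V U); f \<in> Hom (GI_TopSys V U) S T; g \<in> Hom (GI_TopSys V U) S T; snd f = snd g\<rbrakk>
    \<Longrightarrow> f = g"
  by (rule topsys_hom_eqI) (simp_all add: GI_TopSys_def)

lemma GI_TopSys_lift_in:
  "\<lbrakk>S \<in> Ob (GI_TopSys V U); T \<in> Ob (GI_TopSys V U); f \<in> heyting_hom (alg T) (alg S)\<rbrakk>
    \<Longrightarrow> topsys_lift S T f \<in> Hom (GI_TopSys V U) S T"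
  using topsys_lift_in by (auto simp: GI_TopSys_def)

lemma snd_GI_TopSys_hom:
  "f \<in> Hom (GI_TopSys V U) S T \<Longrightarrow> snd f \<in> heyting_hom (alg T) (alg S)"
  by (auto simp: GI_TopSys_def topsys_hom_def)

lemma compose_id_heyting_hom:
  assumes "f \<in> heyting_hom A B"
  shows "compose (carrier A) f (\<lambda>a\<in>carrier A. a) = f"
    "compose (carrier A) (\<lambda>b\<in>carrier B. b) f = f"
  using assms by (auto simp: heyting_hom_def compose_def PiE_def extensional_def Pi_def fun_eq_iff)

lemma compose_id_id:
  "compose A (\<lambda>a\<in>A. a) (\<lambda>a\<in>A. a) = (\<lambda>a\<in>A. a)"
  by (auto simp: compose_def)

theorem theorem7:
  fixes U :: "'a set set" and V :: "'x set set"
  assumes "size_compatible U V"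
  shows "equivalent_categories (GI_TopSys V U) (op_cat (GA U))"
proof -
  let ?C = "GI_TopSys V U" and ?D = "op_cat (GA U)"
  interpret C: category ?C by (rule category_GI_TopSys)
  interpret GA: category "GA U" by (rule category_GA)
  \<comment> \<open>Choice fixes one system \<open>spec A\<close> over each algebra.\<close>
  have "\<forall>A\<in>Ob (GA U). \<exists>S. S \<in> Ob ?C \<and> alg S = A"
    using GI_TopSys_over_algebra[OF assms] by blast
  then obtain spec where "\<forall>A\<in>Ob (GA U). spec A \<in> Ob ?C \<and> alg (spec A) = A"
    by (rule bchoice[THEN exE])
  then have spec: "\<And>A. A \<in> Ob (GA U) \<Longrightarrow> spec A \<in> Ob ?C"
    and alg_spec: "\<And>A. A \<in> Ob (GA U) \<Longrightarrow> alg (spec A) = A" by auto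
  \<comment> \<open>A system has a point, so its algebra is nontrivial, as membership in
    \<open>GA U\<close> demands.\<close>
  have alg_in: "alg S \<in> Ob (GA U)" if "S \<in> Ob ?C" for S
    using that godel_I_topsys.zero_neq_one[of S] godel_I_topsys.alg_godel[of S]
    by (auto simp: GI_TopSys_def GA_def)
  have id_hom: "(\<lambda>a\<in>carrier A. a) \<in> heyting_hom A A" if "A \<in> Ob (GA U)" for A
    using GA.Ident_in[OF that] by (simp add: GA_def)
  have D: "Ob ?D = Ob (GA U)" "\<And>A B. Hom ?D A B = heyting_hom B A"
    "\<And>A. Ident ?D A = (\<lambda>a\<in>carrier A. a)"
    "\<And>A B E g f. Comp ?D A B E g f = compose (carrier E) f g"
    by (simp_all add: op_cat_def GA_def)
  define F :: "(('x, 'a) topsys, ('x \<Rightarrow> 'x) \<times> ('a \<Rightarrow> 'a), 'a heyting, 'a \<Rightarrow> 'a) func"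
    where "F = \<lparr>on_Ob = alg, on_Hom = (\<lambda>S T f. snd f)\<rparr>"
  define G where "G = \<lparr>on_Ob = spec, on_Hom = (\<lambda>A B f. topsys_lift (spec A) (spec B) f)\<rparr>"
  \<comment> \<open>\<open>S\<close> and \<open>spec (alg S)\<close> share their algebra, so its
    identity lifts to morphisms in both directions.\<close>
  define \<eta> where "\<eta> S = topsys_lift S (spec (alg S)) (\<lambda>a\<in>carrier (alg S). a)" for S :: "('x, 'a) topsys"
  have F: "cat_functor ?C ?D F"
    by unfold_locales
      (auto simp: F_def D alg_in snd_GI_TopSys_hom snd_Ident_GI_TopSys snd_Comp_GI_TopSys)
  have lift_in: "topsys_lift (spec A) (spec B) f \<in> Hom ?C (spec A) (spec B)"
    if "A \<in> Ob (GA U)" "B \<in> Ob (GA U)" "f \<in> heyting_hom B A" for A B f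
    using that by (intro GI_TopSys_lift_in) (simp_all add: spec alg_spec)
  have G: "cat_functor ?D ?C G"
  proof
    fix A assume A: "A \<in> Ob ?D"
    then show "on_Ob G A \<in> Ob ?C" by (simp add: G_def D spec)
    show "on_Hom G A A (Ident ?D A) = Ident ?C (on_Ob G A)"
      using A unfolding G_def D
      by (intro GI_TopSys_hom_eqI[of "spec A" V U _ "spec A"])
        (simp_all add: spec alg_spec lift_in id_hom C.Ident_in snd_Ident_GI_TopSys)
  next
    fix A B f assume "A \<in> Ob ?D" "B \<in> Ob ?D" "f \<in> Hom ?D A B"
    then show "on_Hom G A B f \<in> Hom ?C (on_Ob G A) (on_Ob G B)"
      by (simp add: G_def D lift_in)
  next
    fix A B E f g
    assume ob: "A \<in> Ob ?D" "B \<in> Ob ?D" "E \<in> Ob ?D" and f: "f \<in> Hom ?D A B" and g: "g \<in> Hom ?D B E"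
    \<comment> \<open>In \<open>GA U\<close> the arrows run from \<open>E\<close> through
      \<open>B\<close> to \<open>A\<close>, hence the reversed arguments.\<close>
    have "compose (carrier E) f g \<in> heyting_hom E A"
      using GA.Comp_in[of E B A g f] ob f g unfolding D by (simp add: GA_def)
    then show "on_Hom G A E (Comp ?D A B E g f) =
        Comp ?C (on_Ob G A) (on_Ob G B) (on_Ob G E) (on_Hom G B E g) (on_Hom G A B f)"
      using ob f g unfolding G_def D
      by (intro GI_TopSys_hom_eqI[of "spec E" V U _ "spec A"])
        (auto simp: spec alg_spec lift_in snd_Comp_GI_TopSys intro!: C.Comp_in)
  qed
  have \<eta>: "nat_iso ?C ?C id_func (comp_func G F) \<eta>"
    unfolding nat_iso_def
  proof (intro conjI ballI)
    fix S assume S: "S \<in> Ob ?C"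
    let ?T = "spec (alg S)" and ?i = "\<lambda>a\<in>carrier (alg S). a"
    have T: "?T \<in> Ob ?C" "alg ?T = alg S" using S alg_in spec alg_spec by auto
    have i: "?i \<in> heyting_hom (alg S) (alg S)" using S by (simp add: alg_in id_hom)
    have u: "\<eta> S \<in> Hom ?C S ?T" and v: "topsys_lift ?T S ?i \<in> Hom ?C ?T S"
      unfolding \<eta>_def using S T i by (simp_all add: GI_TopSys_lift_in)
    \<comment> \<open>Both composites have the identity as algebra component, so faithfulness makes
      them identities.\<close>
    have "Comp ?C S ?T S (topsys_lift ?T S ?i) (\<eta> S) = Ident ?C S"
      by (rule GI_TopSys_hom_eqI[OF S C.Comp_in[OF S T(1) S u v] C.Ident_in[OF S]])
        (simp add: \<eta>_def snd_Comp_GI_TopSys snd_Ident_GI_TopSys compose_id_id)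
    moreover have "Comp ?C ?T S ?T (\<eta> S) (topsys_lift ?T S ?i) = Ident ?C ?T"
      by (rule GI_TopSys_hom_eqI[OF T(1) C.Comp_in[OF T(1) S T(1) v u] C.Ident_in[OF T(1)]])
        (simp add: \<eta>_def snd_Comp_GI_TopSys snd_Ident_GI_TopSys compose_id_id T)
    ultimately show "iso_arrow ?C (on_Ob id_func S) (on_Ob (comp_func G F) S) (\<eta> S)"
      using u v unfolding iso_arrow_def by (auto simp: id_func_def comp_func_def F_def G_def)
  next
    fix S T f assume S: "S \<in> Ob ?C" and T: "T \<in> Ob ?C" and f: "f \<in> Hom ?C S T"
    let ?S = "spec (alg S)" and ?T = "spec (alg T)"
    have S': "?S \<in> Ob ?C" "alg ?S = alg S" and T': "?T \<in> Ob ?C" "alg ?T = alg T"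
      using S T alg_in spec alg_spec by auto
    have f2: "snd f \<in> heyting_hom (alg T) (alg S)" by (rule snd_GI_TopSys_hom[OF f])
    have uS: "\<eta> S \<in> Hom ?C S ?S" and uT: "\<eta> T \<in> Hom ?C T ?T"
      unfolding \<eta>_def using S T S' T' by (simp_all add: GI_TopSys_lift_in alg_in id_hom)
    have l: "topsys_lift ?S ?T (snd f) \<in> Hom ?C ?S ?T" using lift_in f2 S T alg_in by simp
    \<comment> \<open>On algebras, both sides of the naturality square reduce to
      \<open>snd f\<close>.\<close>
    have "Comp ?C S T ?T (\<eta> T) f = Comp ?C S ?S ?T (topsys_lift ?S ?T (snd f)) (\<eta> S)"
      by (rule GI_TopSys_hom_eqI[OF T'(1) C.Comp_in[OF S T T'(1) f uT] C.Comp_in[OF S S'(1) T'(1) uS l]])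
        (simp add: \<eta>_def snd_Comp_GI_TopSys T' compose_id_heyting_hom[OF f2])
    then show "Comp ?C (on_Ob id_func S) (on_Ob id_func T) (on_Ob (comp_func G F) T)
          (\<eta> T) (on_Hom id_func S T f) =
        Comp ?C (on_Ob id_func S) (on_Ob (comp_func G F) S) (on_Ob (comp_func G F) T)
          (on_Hom (comp_func G F) S T f) (\<eta> S)"
      by (simp add: id_func_def comp_func_def F_def G_def)
  qed
  \<comment> \<open>On objects of \<open>?D\<close> the composite \<open>comp_func F G\<close> is
    the identity, as is its action on arrows: \<open>alg (spec A)\<close> is \<open>A\<close>, and a
    lift of \<open>f\<close> has algebra component \<open>f\<close>.\<close>
  have "nat_iso ?D ?D (comp_func F G) id_func (\<lambda>A. \<lambda>a\<in>carrier A. a)"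
    unfolding nat_iso_def iso_arrow_def D
    by (auto simp: comp_func_def id_func_def F_def G_def alg_spec id_hom compose_id_id
        compose_id_heyting_hom intro!: bexI[OF _ id_hom])
  then show ?thesis
    unfolding equivalent_categories_def
    using F G \<eta> category_GI_TopSys category_op_cat[OF category_GA] by blast
qed

end
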